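(* Let $n = p_1^{k_1} p_2^{k_2} \cdots p_r^{k_r}$ be the prime factorization of a positive integer $n$, with distinct primes $p_i$ and integers $k_i \ge 1$, and let $D = \prod_{i=1}^r (k_i+1)$ be the number of divisors of $n$. Then the Schultz index of the divisor prime graph $G_{Dp(n)}$ is $$S(G_{Dp(n)}) = 2(D-1)\prod_{i=1}^r (2k_i+1) - \prod_{i=1}^r \left( (k_i+1)^2 + k_i \right) + 1.$$
   Context: For a positive integer $n$, the divisor prime graph $G_{Dp(n)}$ is the simple graph whose vertex set is the set of positive divisors of $n$, in which two distinct vertices $x, y$ are adjacent if and only if $\gcd(x,y) = 1$ (no loops). For a connected graph $G$ with degree function $d(\cdot)$ and shortest-path distance $d(u,v)$, the Schultz index is $S(G) = \sum_{\{u,v\}} (d(u)+d(v))\,d(u,v)$, summed over all unordered pairs of distinct vertices. *)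

theory Defs
  imports
    Complex_Main
    "HOL-Computational_Algebra.Primes"
    "Graph_Theory.Graph_Theory"
begin

text \<open>
  Simple graphs are the symmetric, loop-free pair digraphs of the library (locale
  \<^locale>\<open>pair_graph\<close>): each undirected edge is represented by its two orientations.
\<close>

definition divisor_prime_graph :: "nat \<Rightarrow> nat pair_pre_digraph" where
  "divisor_prime_graph n =
     \<lparr> pverts = {d. d dvd n},
       parcs = {(x, y). x dvd n \<and> y dvd n \<and> x \<noteq> y \<and> gcd x y = 1} \<rparr>"

text \<open>
  In a symmetric graph every edge at \<open>v\<close> contributes exactly one outgoing arc, so the
  out-degree is the degree of the undirected graph.
\<close>

definition degree :: "'a pair_pre_digraph \<Rightarrow> 'a \<Rightarrow> nat" where
  "degree G v = out_degree (with_proj G) v"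

text \<open>
  The least cost of a walk from \<open>u\<close> to \<open>v\<close> when every arc costs 1. If there is no such walk,
  the extended-real value is infinite and the conversion turns it into the meaningless value 0;
  the distance is intended for connected graphs only.
\<close>

definition distance :: "'a pair_pre_digraph \<Rightarrow> 'a \<Rightarrow> 'a \<Rightarrow> real" where
  "distance G u v = real_of_ereal (wf_digraph.\<mu> (with_proj G) (\<lambda>_. 1) u v)"

text \<open>
  An unordered pair of distinct vertices is represented by the ordered pair whose first component
  is the smaller one, so that each of them is counted once.
\<close>

definition schultz_index :: "'a::linorder pair_pre_digraph \<Rightarrow> real" where
  "schultz_index G =
     (\<Sum>(u, v) \<in> {(u, v). u \<in> pverts G \<and> v \<in> pverts G \<and> u < v}.
        (real (degree G u) + real (degree G v)) * distance G u v)"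

lemma pair_graph_divisor_prime_graph:
  assumes "n > 0"
  shows "pair_graph (divisor_prime_graph n)"
proof
  show "finite (pverts (divisor_prime_graph n))"
    using assms by (simp add: divisor_prime_graph_def)
  have "parcs (divisor_prime_graph n) \<subseteq> {d. d dvd n} \<times> {d. d dvd n}"
    by (auto simp: divisor_prime_graph_def)
  then show "finite (parcs (divisor_prime_graph n))"
    using assms by (auto intro: finite_subset)
qed (auto simp: divisor_prime_graph_def symmetric_def sym_def gcd.commute)

lemma connected_divisor_prime_graph:
  assumes "n > 0"
  shows "connected (with_proj (divisor_prime_graph n))"
proof -
  interpret pair_graph "divisor_prime_graph n"
    using assms by (rule pair_graph_divisor_prime_graph)
  let ?G = "with_proj (divisor_prime_graph n)"
  have to: "d \<rightarrow>\<^sup>*\<^bsub>?G\<^esub> 1" and "from": "1 \<rightarrow>\<^sup>*\<^bsub>?G\<^esub> d" if "d dvd n" for d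
  proof -
    have "1 \<rightarrow>\<^sup>*\<^bsub>?G\<^esub> d \<and> d \<rightarrow>\<^sup>*\<^bsub>?G\<^esub> 1"
    proof (cases "d = 1")
      case True
      then show ?thesis using reachable_refl[of 1] by (auto simp: divisor_prime_graph_def)
    next
      case False
      then have "(1, d) \<in> parcs (divisor_prime_graph n)" "(d, 1) \<in> parcs (divisor_prime_graph n)"
        using that by (auto simp: divisor_prime_graph_def)
      then show ?thesis by (auto intro: reachable_adjI)
    qed
    then show "d \<rightarrow>\<^sup>*\<^bsub>?G\<^esub> 1" "1 \<rightarrow>\<^sup>*\<^bsub>?G\<^esub> d" by auto
  qed
  have "strongly_connected ?G"
  proof (rule strongly_connectedI)
    show "verts ?G \<noteq> {}" by (auto simp: divisor_prime_graph_def)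
    fix u v assume "u \<in> verts ?G" "v \<in> verts ?G"
    then have "u dvd n" "v dvd n" by (auto simp: divisor_prime_graph_def)
    then show "u \<rightarrow>\<^sup>*\<^bsub>?G\<^esub> v" using to "from" reachable_trans by blast
  qed
  then show ?thesis
    by (auto simp: connected_def strongly_connected_def intro: reachable_mk_symmetricI)
qed

end

theory Submission
  imports Defs
begin

text \<open>
  Two distinct vertices have distance 1 if they are adjacent and 2 otherwise, since 1 is adjacent
  to every other vertex. Summing over ordered pairs, the Schultz index is therefore
  \<open>\<Sum>u. d(u) (2(D - 1) - d(u))\<close>. Let \<open>c(u)\<close> be the number of divisors of \<open>n\<close> coprime to \<open>u\<close>; then
  \<open>d(u) = c(u)\<close> except that \<open>d(1) = c(1) - 1 = D - 1\<close>. The power sums \<open>\<Sum>u. c(u)^m\<close> are multiplicative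
  in \<open>n\<close>, and for \<open>n = p^k\<close> they equal \<open>(k + 1)^m + k\<close>, as \<open>c\<close> is \<open>k + 1\<close> at \<open>1\<close> and 1 at the \<open>k\<close> other
  divisors.
\<close>

section \<open>Coprime divisors and their multiplicative power sums\<close>

definition coprime_divisors :: "nat \<Rightarrow> nat \<Rightarrow> nat set" where
  "coprime_divisors n x = {y. y dvd n \<and> coprime x y}"

text \<open>The parameter \<open>m\<close> lets one computation deliver D (\<open>m = 0\<close>),
  the sum of c (\<open>m = 1\<close>) and the sum of its squares (\<open>m = 2\<close>). The vertex
  1 enters with its full count D, not with its degree D - 1, which keeps the sums
  multiplicative.\<close>

definition coprime_power_sum :: "nat \<Rightarrow> nat \<Rightarrow> nat" where
  "coprime_power_sum m n = (\<Sum>x | x dvd n. card (coprime_divisors n x) ^ m)"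

text \<open>A divisor of \<open>a\<close> is coprime to every divisor of \<open>b\<close>. Hence if
  x * y = x' * y', then x divides x' and y divides y'; exchanging the roles and using antisymmetry
  gives injectivity.\<close>

lemma bij_betw_divisors_mult:
  fixes a b :: nat
  assumes "coprime a b"
  shows "bij_betw (\<lambda>(x, y). x * y) ({x. x dvd a} \<times> {y. y dvd b}) {z. z dvd a * b}"
proof (rule bij_betw_imageI)
  have left: "x dvd x'" if "x dvd a" "y' dvd b" "x * y = x' * y'" for x y x' y' :: nat
  proof -
    have "coprime x y'"
      using that assms by (meson coprime_divisors)
    moreover have "x dvd x' * y'"
      using that(3) by (metis dvd_triv_left)
    ultimately show ?thesis
      by (simp add: coprime_dvd_mult_left_iff)
  qed
  have right: "y dvd y'" if "y dvd b" "x' dvd a" "x * y = x' * y'" for x y x' y' :: nat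
  proof -
    have "coprime y x'"
      using that assms by (meson coprime_divisors coprime_commute)
    moreover have "y dvd x' * y'"
      using that(3) by (metis dvd_triv_right)
    ultimately show ?thesis
      by (simp add: coprime_dvd_mult_right_iff)
  qed
  have "x = x' \<and> y = y'"
    if "x dvd a" "y dvd b" "x' dvd a" "y' dvd b" "x * y = x' * y'" for x y x' y'
    using that left[of x y' y x'] left[of x' y y' x] right[of y x' x y'] right[of y' x x' y]
    by (simp add: dvd_antisym)
  then show "inj_on (\<lambda>(x, y). x * y) ({x. x dvd a} \<times> {y. y dvd b})"
    by (intro inj_onI) auto
  have "z \<in> (\<lambda>(x, y). x * y) ` ({x. x dvd a} \<times> {y. y dvd b})" if "z dvd a * b" for z
  proof -
    from that obtain x y where "z = x * y" "x dvd a" "y dvd b"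
      by (rule dvd_productE)
    then show ?thesis
      by blast
  qed
  then show "(\<lambda>(x, y). x * y) ` ({x. x dvd a} \<times> {y. y dvd b}) = {z. z dvd a * b}"
    by (auto simp: mult_dvd_mono)
qed

text \<open>Coprimality across \<open>a\<close> and \<open>b\<close> is automatic, so of the four
  conditions behind \<open>coprime (x * y) (u * v)\<close> only \<open>coprime x u\<close> and
  \<open>coprime y v\<close> remain. The bijection between divisors therefore restricts to a product
  of the two sets.\<close>

lemma card_coprime_divisors_mult:
  assumes "coprime a b" "x dvd a" "y dvd b"
  shows "card (coprime_divisors (a * b) (x * y)) =
    card (coprime_divisors a x) * card (coprime_divisors b y)"
proof -
  have "bij_betw (\<lambda>(x, y). x * y) (coprime_divisors a x \<times> coprime_divisors b y)
    (coprime_divisors (a * b) (x * y))"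
  proof (rule bij_betw_subset[OF bij_betw_divisors_mult[OF assms(1)]])
    have "coprime x v" "coprime y u" if "u dvd a" "v dvd b" for u v
      using that assms by (meson coprime_divisors coprime_commute)+
    then have iff: "coprime (x * y) (u * v) \<longleftrightarrow> coprime x u \<and> coprime y v"
      if "u dvd a" "v dvd b" for u v
      using that by auto
    have "z \<in> (\<lambda>(x, y). x * y) ` (coprime_divisors a x \<times> coprime_divisors b y)"
      if z: "z \<in> coprime_divisors (a * b) (x * y)" for z
    proof -
      obtain u v where uv: "z = u * v" "u dvd a" "v dvd b"
        using z by (auto simp: coprime_divisors_def elim: dvd_productE)
      with z iff[OF uv(2,3)] show ?thesis
        unfolding coprime_divisors_def by blast
    qed
    \<comment> \<open>The library rules for products are switched off so that \<open>iff\<close>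
      rewrites the coprimality of two products before it is split into four conditions.\<close>
    then show "(\<lambda>(x, y). x * y) ` (coprime_divisors a x \<times> coprime_divisors b y) =
        coprime_divisors (a * b) (x * y)"
      by (auto simp: coprime_divisors_def mult_dvd_mono iff
          simp del: coprime_mult_left_iff coprime_mult_right_iff)
  qed (auto simp: coprime_divisors_def)
  then show ?thesis
    by (simp add: bij_betw_same_card[symmetric] card_cartesian_product)
qed

lemma coprime_power_sum_mult:
  assumes "coprime a b"
  shows "coprime_power_sum m (a * b) = coprime_power_sum m a * coprime_power_sum m b"
proof -
  have "coprime_power_sum m (a * b) =
      (\<Sum>(x, y) \<in> {x. x dvd a} \<times> {y. y dvd b}. card (coprime_divisors (a * b) (x * y)) ^ m)"
    unfolding coprime_power_sum_def
    by (subst sum.reindex_bij_betw[OF bij_betw_divisors_mult[OF assms], symmetric])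
      (simp add: case_prod_unfold)
  also have "\<dots> = (\<Sum>(x, y) \<in> {x. x dvd a} \<times> {y. y dvd b}.
      card (coprime_divisors a x) ^ m * card (coprime_divisors b y) ^ m)"
    by (rule sum.cong) (auto simp: card_coprime_divisors_mult[OF assms] power_mult_distrib)
  also have "\<dots> = coprime_power_sum m a * coprime_power_sum m b"
    by (simp add: coprime_power_sum_def sum_product sum.cartesian_product)
  finally show ?thesis .
qed

lemma coprime_power_sum_prime_power:
  assumes "prime p"
  shows "coprime_power_sum m (p ^ k) = (k + 1) ^ m + k"
proof -
  have divisors: "{x. x dvd p ^ k} = (\<lambda>i. p ^ i) ` {..k}"
    using assms by (auto simp: divides_primepow_nat)
  have inj: "inj_on (\<lambda>i. p ^ i) {..k}"
    using prime_gt_1_nat[OF assms] by (intro inj_onI) simp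
  \<comment> \<open>The divisor 1 is written as \<open>p ^ 0\<close> because it is the term
    \<open>i = 0\<close> of the sum over exponents below.\<close>
  have "coprime_divisors (p ^ k) (p ^ 0) = {x. x dvd p ^ k}"
    by (auto simp: coprime_divisors_def)
  then have one: "card (coprime_divisors (p ^ k) (p ^ 0)) = k + 1"
    by (simp add: divisors card_image[OF inj] del: power_0)
  have other: "card (coprime_divisors (p ^ k) (p ^ i)) = 1" if "i > 0" for i
  proof -
    have "y = 1" if "y dvd p ^ k" "coprime (p ^ i) y" for y
    proof -
      from divisors that(1) obtain j where j: "y = p ^ j"
        by blast
      \<comment> \<open>For \<open>i > 0\<close>, a positive exponent \<open>j\<close> would make
        \<open>p\<close> a common factor, so \<open>j = 0\<close>.\<close>
      have "\<not> coprime p p"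
        using assms by auto
      with that(2) \<open>i > 0\<close> show ?thesis
        by (auto simp: j)
    qed
    then have "coprime_divisors (p ^ k) (p ^ i) = {1}"
      by (auto simp: coprime_divisors_def)
    then show ?thesis
      by simp
  qed
  have "coprime_power_sum m (p ^ k) = (\<Sum>i\<le>k. card (coprime_divisors (p ^ k) (p ^ i)) ^ m)"
    by (simp add: coprime_power_sum_def divisors sum.reindex[OF inj])
  also have "\<dots> = (k + 1) ^ m + (\<Sum>i\<in>{..k} - {0}. card (coprime_divisors (p ^ k) (p ^ i)) ^ m)"
    by (subst sum.remove[of _ 0]) (use one in simp_all)
  also have "(\<Sum>i\<in>{..k} - {0}. card (coprime_divisors (p ^ k) (p ^ i)) ^ m) = k"
    using other by simp
  finally show ?thesis .
qed

lemma coprime_power_sum_prod_prime_powers: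
  assumes "finite I" "\<And>i. i \<in> I \<Longrightarrow> prime (p i)" "inj_on p I"
  shows "coprime_power_sum m (\<Prod>i\<in>I. p i ^ k i) = (\<Prod>i\<in>I. (k i + 1) ^ m + k i)"
  using assms
proof (induction I)
  case empty
  show ?case
    \<comment> \<open>The empty product 1 is read as the zeroth power of an arbitrarily chosen
      prime.\<close>
    using coprime_power_sum_prime_power[of 2 m 0] by simp
next
  case (insert j I)
  have "coprime (p j ^ k j) (\<Prod>i\<in>I. p i ^ k i)"
  proof (rule prod_coprime_right)
    fix i assume "i \<in> I"
    with insert have "p j \<noteq> p i" "prime (p j)" "prime (p i)"
      by auto
    then show "coprime (p j ^ k j) (p i ^ k i)"
      by (simp add: primes_coprime)
  qed
  with insert show ?case
    by (simp add: coprime_power_sum_mult coprime_power_sum_prime_power)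
qed

lemma coprime_power_sum_0: "coprime_power_sum 0 n = card {x. x dvd n}"
  by (simp add: coprime_power_sum_def)

section \<open>Distances, degrees and the Schultz index of general graphs\<close>

context pair_wf_digraph
begin

text \<open>With unit costs a walk costs its length, so the infimum defining \<open>\<mu>\<close> is
  attained at the shortest walk \<open>p\<close>. It is thus finite, and its conversion to a real
  number is faithful.\<close>

lemma distance_eq_length:
  assumes "awalk u p v" "\<And>q. awalk u q v \<Longrightarrow> length p \<le> length q"
  shows "distance G u v = length p"
proof -
  have cost: "awalk_cost (\<lambda>_. 1) q = real (length q)" for q
    by (induction q) simp_all
  have "\<mu> (\<lambda>_. 1) u v = ereal (length p)"
    unfolding \<mu>_def cost using assms by (intro antisym INF_lower2[of p] INF_greatest) auto
  then show ?thesis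
    by (simp add: distance_def)
qed

lemma distance_adjacent:
  assumes "(u, v) \<in> parcs G" "u \<noteq> v"
  shows "distance G u v = 1"
proof -
  have "1 \<le> length q" if "awalk u q v" for q
    using that assms(2) by (cases q) (auto simp: awalk_Nil_iff)
  moreover have "awalk u [(u, v)] v"
    using arc_implies_awalk[OF assms(1)] by simp
  ultimately show ?thesis
    using distance_eq_length[of u "[(u, v)]" v] by simp
qed

text \<open>The empty walk would force \<open>u = v\<close>, and a walk of length 1 would be the arc
  \<open>(u, v)\<close>; the walk through \<open>w\<close> attains the bound 2.\<close>

lemma distance_common_neighbour:
  assumes "(u, w) \<in> parcs G" "(w, v) \<in> parcs G" "(u, v) \<notin> parcs G" "u \<noteq> v"
  shows "distance G u v = 2"
proof -
  have "Suc (Suc 0) \<le> length q" if "awalk u q v" for q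
  proof (cases q)
    case (Cons e es)
    with that assms(3,4) show ?thesis
      by (cases es) (auto simp: awalk_Cons_iff awalk_Nil_iff)
  qed (use that assms(4) in \<open>auto simp: awalk_Nil_iff\<close>)
  moreover have "awalk u [(u, w), (w, v)] v"
    using assms(1,2) in_arcsD2[OF assms(2)] by (auto simp: awalk_Cons_iff awalk_Nil_iff)
  ultimately show ?thesis
    using distance_eq_length[of u "[(u, w), (w, v)]" v] by simp
qed

lemma degree_eq_card_neighbours: "degree G v = card {w. (v, w) \<in> parcs G}"
proof -
  have "out_arcs (with_proj G) v = Pair v ` {w. (v, w) \<in> parcs G}"
    by (auto simp: out_arcs_def)
  then show ?thesis
    by (simp add: degree_def out_degree_def card_image inj_on_def)
qed

end

text \<open>The summand splits into a \<open>degree G u\<close> part and a \<open>degree G v\<close>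
  part. Exchanging the names in the second part moves it to the pairs with \<open>v < u\<close>,
  where by symmetry of the distance it has the same form as the first.\<close>

lemma schultz_index_ordered_pairs:
  fixes G :: "'a::linorder pair_pre_digraph"
  assumes "finite (pverts G)"
    and "\<And>u v. u \<in> pverts G \<Longrightarrow> v \<in> pverts G \<Longrightarrow> distance G u v = distance G v u"
  shows "schultz_index G =
    (\<Sum>u\<in>pverts G. real (degree G u) * (\<Sum>v\<in>pverts G - {u}. distance G u v))"
proof -
  let ?V = "pverts G"
  let ?L = "{(u, v). u \<in> ?V \<and> v \<in> ?V \<and> u < v}"
  let ?R = "{(u, v). u \<in> ?V \<and> v \<in> ?V \<and> v < u}"
  let ?f = "\<lambda>(u, v). real (degree G u) * distance G u v"
  have fin: "finite ?L" "finite ?R"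
    by (rule finite_subset[of _ "?V \<times> ?V"]; use assms(1) in auto)+
  have "sum ?f ?R = (\<Sum>(u, v)\<in>?L. real (degree G v) * distance G u v)"
    by (rule sum.reindex_bij_witness[of _ prod.swap prod.swap]) (auto simp: assms(2))
  then have "schultz_index G = sum ?f ?L + sum ?f ?R"
    by (simp add: schultz_index_def case_prod_unfold sum.distrib[symmetric] distrib_right)
  also have "\<dots> = sum ?f (?L \<union> ?R)"
    using fin by (intro sum.union_disjoint[symmetric]) auto
  also have "?L \<union> ?R = Sigma ?V (\<lambda>u. ?V - {u})"
    by auto
  also have "sum ?f \<dots> = (\<Sum>u\<in>?V. \<Sum>v\<in>?V - {u}. real (degree G u) * distance G u v)"
    using assms(1) by (intro sum.Sigma[symmetric]) auto
  finally show ?thesis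
    by (simp add: sum_distrib_left)
qed

section \<open>The Schultz index of the divisor prime graph\<close>

lemma distance_divisor_prime_graph:
  assumes "n > 0" "u dvd n" "v dvd n" "u \<noteq> v"
  shows "distance (divisor_prime_graph n) u v = (if coprime u v then 1 else 2)"
proof -
  interpret pair_graph "divisor_prime_graph n"
    using assms(1) by (rule pair_graph_divisor_prime_graph)
  show ?thesis
  proof (cases "coprime u v")
    case True
    with assms have "(u, v) \<in> parcs (divisor_prime_graph n)"
      by (simp add: divisor_prime_graph_def)
    with True assms(4) show ?thesis
      by (simp add: distance_adjacent)
  next
    case False
    \<comment> \<open>Since 1 is coprime to everything, it differs from both vertices and is a
      common neighbour of them.\<close>
    then have "u \<noteq> 1" "v \<noteq> 1"
      by auto
    with False assms have "(u, 1) \<in> parcs (divisor_prime_graph n)"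
      "(1, v) \<in> parcs (divisor_prime_graph n)" "(u, v) \<notin> parcs (divisor_prime_graph n)"
      by (auto simp: divisor_prime_graph_def coprime_iff_gcd_eq_1)
    with False assms(4) show ?thesis
      by (simp add: distance_common_neighbour)
  qed
qed

lemma degree_divisor_prime_graph:
  assumes "n > 0" "u dvd n"
  shows "degree (divisor_prime_graph n) u = card {v. v dvd n \<and> v \<noteq> u \<and> coprime u v}"
proof -
  interpret pair_graph "divisor_prime_graph n"
    using assms(1) by (rule pair_graph_divisor_prime_graph)
  show ?thesis
    unfolding degree_eq_card_neighbours using assms(2)
    by (intro arg_cong[of _ _ card]) (auto simp: divisor_prime_graph_def coprime_iff_gcd_eq_1)
qed

text \<open>Each distance is 2 minus the indicator of coprimality. The D - 1 other vertices
  contribute 2 each, and the indicators add up to the degree.\<close>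

lemma sum_distance_divisor_prime_graph:
  assumes "n > 0" "u dvd n"
  shows "(\<Sum>v\<in>{d. d dvd n} - {u}. distance (divisor_prime_graph n) u v) =
    2 * (real (card {d. d dvd n}) - 1) - real (degree (divisor_prime_graph n) u)"
proof -
  let ?V = "{d. d dvd n} - {u}"
  have fin: "finite {d. d dvd n}"
    using assms(1) by simp
  have "(\<Sum>v\<in>?V. distance (divisor_prime_graph n) u v) =
      (\<Sum>v\<in>?V. 2 - (if coprime u v then 1 else 0))"
    using assms by (intro sum.cong) (auto simp: distance_divisor_prime_graph)
  also have "\<dots> = 2 * real (card ?V) - (\<Sum>v\<in>?V. if coprime u v then 1 else 0)"
    by (simp add: sum_subtractf)
  also have "(\<Sum>v\<in>?V. if coprime u v then 1 else 0 :: real) = card (?V \<inter> {v. coprime u v})"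
    using fin by (simp add: sum.If_cases)
  also have "?V \<inter> {v. coprime u v} = {v. v dvd n \<and> v \<noteq> u \<and> coprime u v}"
    by auto
  also have "card \<dots> = degree (divisor_prime_graph n) u"
    using assms by (simp add: degree_divisor_prime_graph)
  also have "real (card ?V) = real (card {d. d dvd n}) - 1"
  proof -
    have "card {d. d dvd n} = Suc (card ?V)"
      using fin assms(2) by (intro card.remove) auto
    then show ?thesis
      by simp
  qed
  finally show ?thesis .
qed

lemma schultz_index_divisor_prime_graph:
  assumes "n > 0"
  shows "schultz_index (divisor_prime_graph n) =
    2 * (real (coprime_power_sum 0 n) - 1) * real (coprime_power_sum 1 n)
      - real (coprime_power_sum 2 n) + 1"
proof -
  let ?V = "{d. d dvd n}"
  let ?D = "real (card ?V)"
  let ?g = "\<lambda>c. c * (2 * (?D - 1) - c)"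
  let ?c = "\<lambda>u. real (card (coprime_divisors n u))"
  let ?d = "\<lambda>u. real (degree (divisor_prime_graph n) u)"
  have fin: "finite ?V"
    using assms by simp
  \<comment> \<open>Away from 1, \<open>u\<close> is not coprime to itself, so leaving out the loop
    removes nothing from the count.\<close>
  have deg: "?d u = ?c u" if "u dvd n" "u \<noteq> 1" for u
  proof -
    have "{v. v dvd n \<and> v \<noteq> u \<and> coprime u v} = coprime_divisors n u"
      using that by (auto simp: coprime_divisors_def)
    then show ?thesis
      using that assms by (simp add: degree_divisor_prime_graph)
  qed
  have c1: "?c 1 = ?D"
    by (simp add: coprime_divisors_def)
  have d1: "?d 1 = ?D - 1"
  proof -
    have "{v. v dvd n \<and> v \<noteq> 1 \<and> coprime 1 v} = ?V - {1}"
      by auto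
    moreover have "card ?V = Suc (card (?V - {1}))"
      using fin by (intro card.remove) auto
    ultimately show ?thesis
      using assms by (simp add: degree_divisor_prime_graph)
  qed
  have pverts: "pverts (divisor_prime_graph n) = ?V"
    by (simp add: divisor_prime_graph_def)
  have "distance (divisor_prime_graph n) u v = distance (divisor_prime_graph n) v u"
    if "u dvd n" "v dvd n" for u v
    using that assms by (cases "u = v") (simp_all add: distance_divisor_prime_graph coprime_commute)
  then have "schultz_index (divisor_prime_graph n) =
      (\<Sum>u\<in>?V. ?d u * (\<Sum>v\<in>?V - {u}. distance (divisor_prime_graph n) u v))"
    unfolding pverts[symmetric] using fin
    by (intro schultz_index_ordered_pairs) (simp_all add: pverts)
  also have "\<dots> = (\<Sum>u\<in>?V. ?g (?d u))"
    using assms by (intro sum.cong) (simp_all add: sum_distance_divisor_prime_graph)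
  \<comment> \<open>The term at 1, the only vertex where degree and c differ, is split off; it is
    put back with c in place of the degree once the other terms have been rewritten.\<close>
  also have "\<dots> = ?g (?d 1) + (\<Sum>u\<in>?V - {1}. ?g (?d u))"
    using fin by (intro sum.remove) auto
  also have "(\<Sum>u\<in>?V - {1}. ?g (?d u)) = (\<Sum>u\<in>?V - {1}. ?g (?c u))"
    using deg by (intro sum.cong) auto
  also have "\<dots> = (\<Sum>u\<in>?V. ?g (?c u)) - ?g (?c 1)"
    using fin by (subst sum.remove[of ?V 1]) auto
  also have "(\<Sum>u\<in>?V. ?g (?c u)) = 2 * (?D - 1) * (\<Sum>u\<in>?V. ?c u) - (\<Sum>u\<in>?V. ?c u ^ 2)"
    by (simp add: sum_distrib_left sum_subtractf[symmetric] algebra_simps power2_eq_square)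
  \<comment> \<open>The final \<open>+ 1\<close> is the correction at the vertex 1:
    \<open>?g (?D - 1) - ?g ?D\<close> equals (D - 1)^2 - D (D - 2) = 1.\<close>
  finally show ?thesis
    unfolding c1 d1
    by (simp add: coprime_power_sum_0 coprime_power_sum_def algebra_simps power2_eq_square)
qed

theorem theorem3p6:
  fixes n r D :: nat and p k :: "nat \<Rightarrow> nat"
  assumes "n > 0"
    and "\<And>i. i \<in> {1..r} \<Longrightarrow> prime (p i)"
    and "inj_on p {1..r}"
    and "\<And>i. i \<in> {1..r} \<Longrightarrow> k i \<ge> 1"
    and "n = (\<Prod>i=1..r. p i ^ k i)"
    and "D = (\<Prod>i=1..r. (k i + 1))"
  shows "schultz_index (divisor_prime_graph n) =
    2 * (real D - 1) * (\<Prod>i=1..r. (2 * real (k i) + 1))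
      - (\<Prod>i=1..r. ((real (k i) + 1)\<^sup>2 + real (k i))) + 1"
proof -
  have sums: "coprime_power_sum m n = (\<Prod>i=1..r. (k i + 1) ^ m + k i)" for m
    unfolding assms(5) using assms(2,3) by (intro coprime_power_sum_prod_prime_powers) auto
  \<comment> \<open>For \<open>m\<close> equal to 0, 1 and 2 the factor
    \<open>(k i + 1) ^ m + k i\<close> becomes 1 + k i, 2 k i + 1 and (k i + 1)^2 + k i, which are
    the three products of the claim.\<close>
  have "real (coprime_power_sum 0 n) = real D"
    by (simp add: sums assms(6) add.commute)
  moreover have "real (coprime_power_sum 1 n) = (\<Prod>i=1..r. (2 * real (k i) + 1))"
    by (simp add: sums algebra_simps)
  moreover have "real (coprime_power_sum 2 n) = (\<Prod>i=1..r. ((real (k i) + 1)\<^sup>2 + real (k i)))"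
    by (simp add: sums algebra_simps)
  ultimately show ?thesis
    using schultz_index_divisor_prime_graph[OF assms(1)] by simp
qed

end
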